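(* Let $0<q<1$. The initial value problem of the fractional-order Lagrange system, $$D_t^q x(t) = x^1(t)\,A\,x(t) + x^3(t)\,B\,x(t),\qquad x(0)=x_0,\qquad t\in(0,\tau),$$ for the unknown function $x(t)=(x^1(t),x^2(t),x^3(t))^T\in\mathbf{R}^3$, where $$A=\begin{pmatrix}0&0&0\\0&0&0\\0&1&0\end{pmatrix},\qquad B=\begin{pmatrix}0&1&0\\1&0&0\\0&0&0\end{pmatrix},$$ has a unique solution.
   Context: Superscripts on $x$ denote components, not powers. In components the equation is the fractional-order Lagrange system $D_t^q x^1=x^2x^3$, $D_t^q x^2=x^1x^3$, $D_t^q x^3=x^1x^2$. The vector $x_0\in\mathbf{R}^3$ is the initial value, and $(0,\tau)$ is the time interval on which the problem is posed, with no further condition stated on $\tau$. For $0<q<1$, $D_t^q$ is the Caputo derivative $D_t^q f(t)=I_t^{1-q}f'(t)$, where $I_t^{\alpha}g(t)=\frac{1}{\Gamma(\alpha)}\int_0^t (t-s)^{\alpha-1}g(s)\,ds$ for $\alpha>0$ is the Riemann-Liouville integral of order $\alpha$ and $\Gamma$ is the Euler Gamma function.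
   Formalization: Existence of a solution on (0,τ) is claimed only for all sufficiently small τ (depending on q and x_0), since for x_0=(1,1,1) solutions blow up and none exists when τ^q > Γ(q); uniqueness is claimed for every τ > 0. *)

theory Defs
  imports "HOL-Analysis.Analysis"
begin

text \<open>Riemann-Liouville integral of order \<open>\<alpha>\<close>, based at 0. The integral is a Bochner integral with
  respect to Lebesgue measure, hence taken componentwise for vector-valued \<open>g\<close>. It is 0 by convention
  when the integrand is not integrable, so integrability is always required separately.\<close>

definition rl_integrable ::
  "real \<Rightarrow> (real \<Rightarrow> 'a::{banach, second_countable_topology}) \<Rightarrow> real \<Rightarrow> bool" where
  "rl_integrable \<alpha> g t \<longleftrightarrow>
     set_integrable lborel {0<..<t} (\<lambda>s. (t - s) powr (\<alpha> - 1) *\<^sub>R g s)"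

definition rl_integral ::
  "real \<Rightarrow> (real \<Rightarrow> 'a::{banach, second_countable_topology}) \<Rightarrow> real \<Rightarrow> 'a" where
  "rl_integral \<alpha> g t =
     (1 / Gamma \<alpha>) *\<^sub>R (LINT s:{0<..<t}|lborel. (t - s) powr (\<alpha> - 1) *\<^sub>R g s)"

text \<open>Caputo derivative of order \<open>0 < q < 1\<close>. Differentiability is required only on the open interval
  \<open>(0,t)\<close>: functions such as \<open>t powr q\<close>, whose derivative is unbounded at 0, must be admitted.\<close>

definition caputo_differentiable ::
  "real \<Rightarrow> (real \<Rightarrow> 'a::{banach, second_countable_topology}) \<Rightarrow> real \<Rightarrow> bool" where
  "caputo_differentiable q f t \<longleftrightarrow>
     (\<forall>s\<in>{0<..<t}. f differentiable (at s)) \<and>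
     rl_integrable (1 - q) (\<lambda>s. vector_derivative f (at s)) t"

definition caputo_deriv ::
  "real \<Rightarrow> (real \<Rightarrow> 'a::{banach, second_countable_topology}) \<Rightarrow> real \<Rightarrow> 'a" where
  "caputo_deriv q f t = rl_integral (1 - q) (\<lambda>s. vector_derivative f (at s)) t"

definition lagrange_A :: "real^3^3" where
  "lagrange_A = vector [vector [0, 0, 0],
                        vector [0, 0, 0],
                        vector [0, 1, 0]]"

definition lagrange_B :: "real^3^3" where
  "lagrange_B = vector [vector [0, 1, 0],
                        vector [1, 0, 0],
                        vector [0, 0, 0]]"

text \<open>Only the values of \<open>x\<close> on \<open>[0,\<tau>)\<close> matter. Continuity at 0 is what ties the equation, which
  lives on \<open>(0,\<tau>)\<close>, to the initial value.\<close>

definition lagrange_solution ::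
  "real \<Rightarrow> real \<Rightarrow> real^3 \<Rightarrow> (real \<Rightarrow> real^3) \<Rightarrow> bool" where
  "lagrange_solution q \<tau> x0 x \<longleftrightarrow>
     continuous_on {0..<\<tau>} x \<and>
     x 0 = x0 \<and>
     (\<forall>t\<in>{0<..<\<tau>}.
        caputo_differentiable q x t \<and>
        caputo_deriv q x t =
          (x t $ 1) *\<^sub>R (lagrange_A *v x t) + (x t $ 3) *\<^sub>R (lagrange_B *v x t))"

end

theory Submission
  imports Defs
begin

text \<open>The right-hand side is \<open>\<beta> (x t) (x t)\<close> for a bounded bilinear \<open>\<beta>\<close>, and both halves are proved for an
  arbitrary such \<open>\<beta>\<close> on a Euclidean space. Existence: the ansatz \<open>x t = (\<Sum>n. t\<^bsup>q n\<^esup> a\<^sub>n)\<close> turns the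
  equation into a convolution recursion for \<open>a\<^sub>n\<close> with bounded Gamma quotients, so \<open>a\<^sub>n\<close> grows at most
  geometrically and the series, a power series in \<open>t\<^bsup>q\<^esup>\<close>, converges near 0. Uniqueness: Fubini and
  the Beta integral turn the equation into the Volterra equation \<open>x = x 0 + I\<^bsup>q\<^esup> (\<beta> x x)\<close>, whose kernel is a
  contraction in the norm weighted by \<open>exp (- l t)\<close> with large \<open>l\<close>.\<close>

section \<open>The Beta integral on an arbitrary interval\<close>

text \<open>The substitution \<open>s = r + (t - r) * x\<close> pulls the integrand back to the Beta
  integrand on the unit interval. The formula serves to invert the Caputo derivative, to integrate
  the singular kernels and to compute the Caputo derivative of powers of \<open>t\<close>.\<close>

lemma has_bochner_integral_Beta_kernel:
  fixes a b r t :: real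
  assumes a: "0 < a" and b: "0 < b" and rt: "r < t"
  shows "has_bochner_integral lborel
    (\<lambda>s. indicator {r<..<t} s * ((t - s) powr (b - 1) * (s - r) powr (a - 1)))
    ((t - r) powr (a + b - 1) * Beta a b)"
proof -
  have B0: "0 < Beta a b"
    using a b by (simp add: Beta_def Gamma_real_pos)
  have "((\<lambda>x. x powr (a - 1) * (1 - x) powr (b - 1)) has_integral Beta a b) {0<..<1}"
    using has_integral_Beta_real[OF a b] by (simp add: has_integral_Icc_iff_Ioo)
  from nn_integral_has_integral_lebesgue[OF _ this]
  have beta: "has_bochner_integral lborel
      (\<lambda>x. indicator {0<..<1} x * (x powr (a - 1) * (1 - x) powr (b - 1))) (Beta a b)"
    using B0 by (intro has_bochner_integral_nn_integral) auto
  have unit: "has_bochner_integral lborel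
      (\<lambda>x. (t - r) powr (a + b - 2) *
        (indicator {0<..<1} x * (x powr (a - 1) * (1 - x) powr (b - 1))))
      ((t - r) powr (a + b - 2) * Beta a b)"
    by (intro has_bochner_integral_mult_right beta)
  have pointwise: "indicator {r<..<t} (r + (t - r) * x) *
        ((t - (r + (t - r) * x)) powr (b - 1) * (r + (t - r) * x - r) powr (a - 1))
      = (t - r) powr (a + b - 2) *
        (indicator {0<..<1} x * (x powr (a - 1) * (1 - x) powr (b - 1)))" for x
  proof (cases "0 < x \<and> x < 1")
    case True
    have "(t - r) * x < t - r"
      using True rt by simp
    then have "r + (t - r) * x < t" by linarith
    then have mem: "r + (t - r) * x \<in> {r<..<t}"
      using True rt by simp
    have "t - (r + (t - r) * x) = (t - r) * (1 - x)"
      by (simp add: algebra_simps)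
    then have e1: "(t - (r + (t - r) * x)) powr (b - 1) = (t - r) powr (b - 1) * (1 - x) powr (b - 1)"
      using True rt by (simp add: powr_mult)
    have e2: "(r + (t - r) * x - r) powr (a - 1) = (t - r) powr (a - 1) * x powr (a - 1)"
      using True rt by (simp add: powr_mult)
    have e3: "(t - r) powr (a + b - 2) = (t - r) powr (a - 1) * (t - r) powr (b - 1)"
      by (simp add: powr_add[symmetric])
    show ?thesis
      unfolding e1 e2 e3 indicator_simps(1)[OF mem] using True by simp
  next
    case False
    have "\<not> (0 < (t - r) * x \<and> (t - r) * x < (t - r) * 1)"
      using False rt by (simp add: zero_less_mult_iff)
    then have "r + (t - r) * x \<notin> {r<..<t}" by auto
    then show ?thesis using False by simp
  qed
  \<comment> \<open>The two kernel powers contribute the exponent \<open>a + b - 2\<close>; the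
    Jacobian \<open>t - r\<close> accounts for the remaining factor.\<close>
  have val: "((t - r) powr (a + b - 1) * Beta a b) /\<^sub>R \<bar>t - r\<bar> = (t - r) powr (a + b - 2) * Beta a b"
  proof -
    have "(t - r) powr (a + b - 1) = (t - r) powr (a + b - 2) * (t - r)"
      using rt powr_add[of "t - r" "a + b - 2" 1] by simp
    then show ?thesis using rt by simp
  qed
  have "t - r \<noteq> 0" using rt by simp
  then show ?thesis
    by (rule iffD2[OF lborel_has_bochner_integral_real_affine_iff[where t = r]])
      (unfold pointwise val, rule unit)
qed

subsection \<open>Uniqueness via the Volterra equation\<close>

text \<open>Composing the two fractional integrals gives a double integral of the derivative against
  a product of kernels. After Fubini, the integral over the intermediate variable is
  \<open>Beta (1 - q) q\<close>, which equals \<open>Gamma (1 - q) * Gamma q\<close> and cancels the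
  normalising factors, so only the plain integral of the derivative is left.\<close>

lemma rl_integral_caputo_deriv:
  fixes f :: "real \<Rightarrow> 'a::euclidean_space"
  assumes q: "0 < q" "q < 1" and t: "0 < t"
    and cont: "continuous_on {0..t} f"
    and caputo: "caputo_differentiable q f t"
  shows "rl_integral q (caputo_deriv q f) t = f t - f 0"
proof -
  define f' where "f' s = vector_derivative f (at s)" for s
  define g where "g s = indicator {0<..<t} s *\<^sub>R f' s" for s
  have deriv: "(f has_vector_derivative f' s) (at s)" if "s \<in> {0<..<t}" for s
    using caputo that unfolding caputo_differentiable_def f'_def
    by (auto simp: vector_derivative_works[symmetric])
  have int: "integrable lborel (\<lambda>s. indicator {0<..<t} s *\<^sub>R (t - s) powr - q *\<^sub>R f' s)"
    using caputo unfolding caputo_differentiable_def rl_integrable_def set_integrable_def f'_def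
    by simp
  \<comment> \<open>Measurability of the derivative is recovered from the integrable product: the
    factor \<open>(t - s) powr q\<close> cancels the singular weight on
    \<open>(0, t)\<close>.\<close>
  have "(\<lambda>s. (t - s) powr q *\<^sub>R (indicator {0<..<t} s *\<^sub>R (t - s) powr - q *\<^sub>R f' s))
      \<in> borel_measurable lborel"
    using borel_measurable_integrable[OF int] by measurable
  also have "(\<lambda>s. (t - s) powr q *\<^sub>R (indicator {0<..<t} s *\<^sub>R (t - s) powr - q *\<^sub>R f' s)) = g"
    by (rule ext) (auto simp: g_def indicator_def powr_minus)
  finally have g_meas [measurable]: "g \<in> borel_measurable borel" by simp
  \<comment> \<open>On \<open>(0, t)\<close> the weight \<open>(t - s) powr - q\<close> is at least
    \<open>t powr - q\<close>, so weighted integrability implies plain integrability.\<close>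
  have g_int: "integrable lborel g"
  proof (rule Bochner_Integration.integrable_bound)
    show "integrable lborel
        (\<lambda>s. t powr q *\<^sub>R (indicator {0<..<t} s *\<^sub>R (t - s) powr - q *\<^sub>R f' s))"
      using int by (rule integrable_scaleR_right)
    have "norm (f' s) \<le> t powr q * (t - s) powr - q * norm (f' s)" if "0 < s" "s < t" for s
    proof -
      have "1 = (t - s) powr q * (t - s) powr - q"
        using that by (simp add: powr_minus)
      also have "\<dots> \<le> t powr q * (t - s) powr - q"
        using that q by (intro mult_right_mono powr_mono2) auto
      finally have "1 * norm (f' s) \<le> (t powr q * (t - s) powr - q) * norm (f' s)"
        by (rule mult_right_mono) simp
      then show ?thesis by simp
    qed
    then show "AE s in lborel. norm (g s) \<le>
        norm (t powr q *\<^sub>R (indicator {0<..<t} s *\<^sub>R (t - s) powr - q *\<^sub>R f' s))"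
      by (intro AE_I2) (auto simp: g_def indicator_def)
  qed simp
  \<comment> \<open>The fundamental theorem asks for continuity up to the end points and for
    derivatives only inside; \<open>g_int\<close> identifies its Henstock integral with the Lebesgue
    one.\<close>
  have ftc: "(\<integral>s. g s \<partial>lborel) = f t - f 0"
  proof -
    have si: "set_integrable lborel {0<..<t} f'"
      using g_int by (simp add: set_integrable_def g_def[abs_def])
    have "(f' has_integral f t - f 0) {0..t}"
      using t cont deriv by (intro fundamental_theorem_of_calculus_interior) auto
    then have "integral {0<..<t} f' = f t - f 0"
      by (auto simp: has_integral_Icc_iff_Ioo)
    then show ?thesis
      using set_borel_integral_eq_integral(2)[OF si]
      by (simp add: set_lebesgue_integral_def g_def)
  qed
  define k where "k r s = indicator {r<..<t} s * ((t - s) powr (q - 1) * (s - r) powr (- q))" for r s :: real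
  \<comment> \<open>The exponents \<open>1 - q\<close> and \<open>q\<close> add up to 1, so the
    power of \<open>t - r\<close> disappears and the value does not depend on
    \<open>r\<close>.\<close>
  have k_bochner: "has_bochner_integral lborel (k r) (Beta (1 - q) q)" if "r < t" for r
    using has_bochner_integral_Beta_kernel[of "1 - q" q r t] q that by (simp add: k_def[abs_def])
  have k_meas [measurable]: "(\<lambda>(r, s). k r s) \<in> borel_measurable (borel \<Otimes>\<^sub>M borel)"
  proof -
    have "(\<lambda>(r, s). k r s) = (\<lambda>p. indicator {p. fst p < snd p \<and> snd p < t} p *
        ((t - snd p) powr (q - 1) * (snd p - fst p) powr (- q)))"
      by (auto simp: k_def fun_eq_iff indicator_def)
    also have "\<dots> \<in> borel_measurable (borel \<Otimes>\<^sub>M borel)"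
      by measurable
    finally show ?thesis .
  qed
  have k_nonneg: "0 \<le> k r s" for r s by (simp add: k_def)
  have F_int: "integrable (lborel \<Otimes>\<^sub>M lborel) (\<lambda>(r, s). k r s *\<^sub>R g r)"
  proof (rule lborel_pair.Fubini_integrable)
    show "(\<lambda>(r, s). k r s *\<^sub>R g r) \<in> borel_measurable (lborel \<Otimes>\<^sub>M lborel)"
    proof -
      have "(\<lambda>p. (case p of (r, s) \<Rightarrow> k r s) *\<^sub>R g (fst p)) \<in> borel_measurable (borel \<Otimes>\<^sub>M borel)"
        by measurable
      then show ?thesis by (simp add: case_prod_unfold)
    qed
    have "(\<integral>s. norm (k r s *\<^sub>R g r) \<partial>lborel) = Beta (1 - q) q * norm (g r)" for r
    proof (cases "r < t")
      case True
      have "(\<integral>s. norm (k r s *\<^sub>R g r) \<partial>lborel) = (\<integral>s. k r s \<partial>lborel) * norm (g r)"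
        by (simp add: k_nonneg)
      then show ?thesis
        using has_bochner_integral_integral_eq[OF k_bochner[OF True]] by simp
    qed (simp add: g_def)
    then show "integrable lborel (\<lambda>r. \<integral>s. norm (case (r, s) of (r, s) \<Rightarrow> k r s *\<^sub>R g r) \<partial>lborel)"
      using g_int by (simp only: prod.case) simp
    have "integrable lborel (\<lambda>s. k r s *\<^sub>R g r)" for r
      using k_bochner[of r, THEN integrable.intros]
      by (cases "r < t") (auto simp: g_def)
    then show "AE r in lborel. integrable lborel (\<lambda>s. case (r, s) of (r, s) \<Rightarrow> k r s *\<^sub>R g r)"
      by simp
  qed
  have "rl_integral q (caputo_deriv q f) t =
      (1 / Gamma q) *\<^sub>R (\<integral>s. (1 / Gamma (1 - q)) *\<^sub>R (\<integral>r. k r s *\<^sub>R g r \<partial>lborel) \<partial>lborel)"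
  proof -
    \<comment> \<open>This holds for every \<open>s\<close>: where the inner integrand fails to be
      integrable, both sides are 0 by convention.\<close>
    have "indicator {0<..<t} s *\<^sub>R ((t - s) powr (q - 1) *\<^sub>R caputo_deriv q f s)
        = (1 / Gamma (1 - q)) *\<^sub>R (\<integral>r. k r s *\<^sub>R g r \<partial>lborel)" for s
    proof -
      have "indicator {0<..<t} s *\<^sub>R ((t - s) powr (q - 1) *\<^sub>R caputo_deriv q f s)
          = (1 / Gamma (1 - q)) *\<^sub>R (indicator {0<..<t} s * (t - s) powr (q - 1)) *\<^sub>R
             (\<integral>r. indicator {0<..<s} r *\<^sub>R (s - r) powr (- q) *\<^sub>R f' r \<partial>lborel)"
        by (simp add: caputo_deriv_def rl_integral_def set_lebesgue_integral_def f'_def)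
      also have "(indicator {0<..<t} s * (t - s) powr (q - 1)) *\<^sub>R
             (\<integral>r. indicator {0<..<s} r *\<^sub>R (s - r) powr (- q) *\<^sub>R f' r \<partial>lborel)
          = (\<integral>r. (indicator {0<..<t} s * (t - s) powr (q - 1)) *\<^sub>R
             (indicator {0<..<s} r *\<^sub>R (s - r) powr (- q) *\<^sub>R f' r) \<partial>lborel)"
        by (rule integral_scaleR_right[symmetric])
      also have "\<dots> = (\<integral>r. k r s *\<^sub>R g r \<partial>lborel)"
        by (intro Bochner_Integration.integral_cong refl)
          (auto simp: k_def g_def indicator_def)
      finally show ?thesis .
    qed
    then show ?thesis
      by (simp only: rl_integral_def set_lebesgue_integral_def)
  qed
  also have "\<dots> = (1 / (Gamma q * Gamma (1 - q))) *\<^sub>R (\<integral>s. (\<integral>r. k r s *\<^sub>R g r \<partial>lborel) \<partial>lborel)"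
    by simp
  also have "(\<integral>s. (\<integral>r. k r s *\<^sub>R g r \<partial>lborel) \<partial>lborel) = (\<integral>r. (\<integral>s. k r s *\<^sub>R g r \<partial>lborel) \<partial>lborel)"
    by (rule lborel_pair.Fubini_integral[OF F_int])
  also have "\<dots> = (\<integral>r. Beta (1 - q) q *\<^sub>R g r \<partial>lborel)"
  proof (intro Bochner_Integration.integral_cong refl)
    fix r
    show "(\<integral>s. k r s *\<^sub>R g r \<partial>lborel) = Beta (1 - q) q *\<^sub>R g r"
    proof (cases "r < t")
      case True
      then show ?thesis
        using has_bochner_integral_integral_eq[OF k_bochner[OF True]]
          k_bochner[OF True, THEN integrable.intros] by simp
    qed (simp add: g_def)
  qed
  also have "\<dots> = Beta (1 - q) q *\<^sub>R (f t - f 0)"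
    by (simp add: ftc)
  also have "(1 / (Gamma q * Gamma (1 - q))) *\<^sub>R \<dots> = f t - f 0"
    using q by (simp add: Beta_def Gamma_real_pos less_imp_neq[symmetric])
  finally show ?thesis .
qed

section \<open>Singular kernels: integrability and exponential damping\<close>

lemma set_integrable_powr_kernel:
  fixes a t :: real
  assumes "0 < a"
  shows "set_integrable lborel {0<..<t} (\<lambda>s. (t - s) powr (a - 1))"
proof (cases "0 < t")
  case True
  \<comment> \<open>With one Beta parameter equal to 1, its factor becomes a \<open>powr 0\<close>,
    which is 1 on the open interval.\<close>
  note integrable.intros[OF has_bochner_integral_Beta_kernel[OF zero_less_one assms True]]
  then have "integrable lborel (\<lambda>s. indicator {0<..<t} s * ((t - s) powr (a - 1) * s powr 0))"
    by simp
  also have "(\<lambda>s. indicator {0<..<t} s * ((t - s) powr (a - 1) * s powr 0))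
      = (\<lambda>s. indicator {0<..<t} s * (t - s) powr (a - 1))"
    by (auto simp: indicator_def)
  finally show ?thesis
    by (simp add: set_integrable_def)
qed (simp add: set_integrable_def)

lemma set_integrable_powr:
  fixes a t :: real
  assumes "0 < a"
  shows "set_integrable lborel {0<..<t} (\<lambda>u. u powr (a - 1))"
proof (cases "0 < t")
  case True
  note integrable.intros[OF has_bochner_integral_Beta_kernel[OF assms zero_less_one True]]
  then have "integrable lborel (\<lambda>u. indicator {0<..<t} u * ((t - u) powr 0 * u powr (a - 1)))"
    by simp
  also have "(\<lambda>u. indicator {0<..<t} u * ((t - u) powr 0 * u powr (a - 1)))
      = (\<lambda>u. indicator {0<..<t} u * u powr (a - 1))"
    by (auto simp: indicator_def)
  finally show ?thesis
    by (simp add: set_integrable_def)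
qed (simp add: set_integrable_def)

lemma set_integrable_powr_kernel_scaleR:
  fixes g :: "real \<Rightarrow> 'a::euclidean_space"
  assumes a: "0 < a" and cont: "continuous_on {0..t} g"
  shows "set_integrable lborel {0<..<t} (\<lambda>s. (t - s) powr (a - 1) *\<^sub>R g s)"
proof -
  have "bounded (g ` {0..t})"
    using compact_continuous_image[OF cont] compact_imp_bounded by blast
  then obtain M where M: "\<And>s. s \<in> {0..t} \<Longrightarrow> norm (g s) \<le> M"
    unfolding bounded_iff by blast
  have [measurable]: "(\<lambda>s. indicator {0<..<t} s *\<^sub>R g s) \<in> borel_measurable borel"
    by (intro borel_measurable_continuous_on_indicator continuous_on_subset[OF cont]) auto
  show ?thesis
    unfolding set_integrable_def
  proof (rule Bochner_Integration.integrable_bound)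
    show "integrable lborel (\<lambda>s. M *\<^sub>R indicator {0<..<t} s *\<^sub>R (t - s) powr (a - 1))"
      using set_integrable_powr_kernel[OF a, of t] unfolding set_integrable_def
      by (rule integrable_scaleR_right)
    have "(\<lambda>s. (t - s) powr (a - 1) *\<^sub>R (indicator {0<..<t} s *\<^sub>R g s)) \<in> borel_measurable borel"
      by measurable
    then show "(\<lambda>s. indicator {0<..<t} s *\<^sub>R (t - s) powr (a - 1) *\<^sub>R g s) \<in> borel_measurable lborel"
      by (simp add: mult.commute)
    show "AE s in lborel. norm (indicator {0<..<t} s *\<^sub>R (t - s) powr (a - 1) *\<^sub>R g s)
        \<le> norm (M *\<^sub>R indicator {0<..<t} s *\<^sub>R (t - s) powr (a - 1))"
      using M by (intro AE_I2)
        (auto simp: indicator_def abs_mult mult.commute intro!: mult_left_mono order_trans[OF M abs_ge_self])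
  qed
qed

text \<open>Dominated convergence along \<open>l = n + 1\<close>: the damped integrands tend to 0
  pointwise below the integrable function \<open>u powr (q - 1)\<close>. This supplies the weight
  that makes the Volterra operator contracting.\<close>

lemma exponential_weight_small_mass:
  fixes q b e :: real
  assumes q: "0 < q" and e: "0 < e"
  obtains l where "0 < l"
    "(LINT u:{0<..<b}|lborel. u powr (q - 1) * exp (- l * u)) < e"
proof -
  have "(\<lambda>n. \<integral>u. indicator {0<..<b} u *\<^sub>R (u powr (q - 1) * exp (- real (Suc n) * u)) \<partial>lborel)
      \<longlonglongrightarrow> (\<integral>(u::real). 0 \<partial>lborel)"
  proof (rule integral_dominated_convergence)
    show "integrable lborel (\<lambda>u. indicator {0<..<b} u *\<^sub>R u powr (q - 1))"
      using set_integrable_powr[OF q] by (simp add: set_integrable_def)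
    show "AE u in lborel. (\<lambda>n. indicator {0<..<b} u *\<^sub>R (u powr (q - 1) * exp (- real (Suc n) * u))) \<longlonglongrightarrow> 0"
    proof (intro AE_I2)
      fix u :: real
      show "(\<lambda>n. indicator {0<..<b} u *\<^sub>R (u powr (q - 1) * exp (- real (Suc n) * u))) \<longlonglongrightarrow> 0"
      proof (cases "0 < u")
        case True
        have "(\<lambda>n. exp (- u) ^ Suc n) \<longlonglongrightarrow> 0"
          using True by (intro LIMSEQ_Suc LIMSEQ_power_zero) auto
        then have "(\<lambda>n. exp (- real (Suc n) * u)) \<longlonglongrightarrow> 0"
          by (simp only: exp_of_nat_mult[symmetric] mult_minus_right mult_minus_left)
        then show ?thesis
          using tendsto_mult_left[of _ 0 sequentially "indicator {0<..<b} u * u powr (q - 1)"]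
          by (simp add: mult.assoc)
      qed simp
    qed
    show "AE u in lborel. norm (indicator {0<..<b} u *\<^sub>R (u powr (q - 1) * exp (- real (Suc n) * u)))
        \<le> indicator {0<..<b} u *\<^sub>R u powr (q - 1)" for n
      by (intro AE_I2) (auto simp: indicator_def abs_mult intro!: mult_left_le mult_nonpos_nonneg)
  qed simp_all
  then have "\<forall>\<^sub>F n in sequentially.
      (\<integral>u. indicator {0<..<b} u *\<^sub>R (u powr (q - 1) * exp (- real (Suc n) * u)) \<partial>lborel) < e"
    using e by (auto dest: order_tendstoD(2))
  then obtain n where
    "(\<integral>u. indicator {0<..<b} u *\<^sub>R (u powr (q - 1) * exp (- real (Suc n) * u)) \<partial>lborel) < e"
    by (meson eventually_happens trivial_limit_sequentially)
  then show thesis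
    by (intro that[of "real (Suc n)"]) (simp_all add: set_lebesgue_integral_def)
qed

section \<open>Weighted Gronwall argument and uniqueness\<close>

text \<open>At a maximum point \<open>t0\<close> of \<open>v t = exp (- l * t) * u t\<close> the
  inequality yields \<open>v t0 \<le> 1 / 2 * v t0\<close> once \<open>l\<close> is large, so the
  maximum is 0. Thus neither \<open>b\<close> nor \<open>L\<close> has to be small.\<close>

lemma fractional_gronwall_zero:
  fixes u :: "real \<Rightarrow> real"
  assumes q: "0 < q" and L: "0 \<le> L"
    and cont: "continuous_on {0..b} u"
    and nonneg: "\<And>t. t \<in> {0..b} \<Longrightarrow> 0 \<le> u t"
    and ineq: "\<And>t. t \<in> {0..b} \<Longrightarrow> u t \<le> L * (LINT s:{0<..<t}|lborel. (t - s) powr (q - 1) * u s)"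
    and t: "t \<in> {0..b}"
  shows "u t = 0"
proof -
  \<comment> \<open>The bound \<open>1 / (2 * (L + 1))\<close> makes \<open>L\<close> times the
    kernel mass at most 1/2; taking \<open>L + 1\<close> keeps the denominator positive when
    \<open>L = 0\<close>.\<close>
  obtain l where l: "0 < l" and
    small: "(LINT u:{0<..<b}|lborel. u powr (q - 1) * exp (- l * u)) < 1 / (2 * (L + 1))"
    using exponential_weight_small_mass[OF q, of "1 / (2 * (L + 1))" b] L by auto
  define m where "m = (LINT u:{0<..<b}|lborel. u powr (q - 1) * exp (- l * u))"
  have m0: "0 \<le> m"
    unfolding m_def set_lebesgue_integral_def by (intro integral_nonneg_AE) auto
  have Lm: "L * m \<le> 1 / 2"
  proof -
    have "L * m \<le> (L + 1) * (1 / (2 * (L + 1)))"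
      using small m0 L by (intro mult_mono) (auto simp: m_def)
    also have "\<dots> = 1 / 2"
      using L by (simp add: field_simps)
    finally show ?thesis .
  qed
  define v where "v t = exp (- l * t) * u t" for t
  have "continuous_on {0..b} v"
    unfolding v_def by (intro continuous_intros cont)
  then obtain t0 where t0: "t0 \<in> {0..b}" and max: "\<And>s. s \<in> {0..b} \<Longrightarrow> v s \<le> v t0"
    using continuous_attains_sup[of "{0..b}" v] t by auto
  define K where "K = (LINT s:{0<..<t0}|lborel. (t0 - s) powr (q - 1) * exp (- l * (t0 - s)))"
  have int0: "set_integrable lborel {0<..<b} (\<lambda>u. u powr (q - 1) * exp (- l * u))"
    unfolding set_integrable_def
  proof (rule Bochner_Integration.integrable_bound)
    show "integrable lborel (\<lambda>u. indicator {0<..<b} u *\<^sub>R u powr (q - 1))"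
      using set_integrable_powr[OF q] by (simp add: set_integrable_def)
  qed (use l in \<open>auto simp: indicator_def intro!: AE_I2 mult_left_le\<close>)
  \<comment> \<open>The reflection \<open>s\<close> to \<open>t0 - s\<close> turns the convolution
    kernel into the damped weight on \<open>(0, t0)\<close>, whose mass is at most the mass
    \<open>m\<close> on \<open>(0, b)\<close>.\<close>
  have K_eq: "K = (LINT u:{0<..<t0}|lborel. u powr (q - 1) * exp (- l * u))"
    unfolding K_def set_lebesgue_integral_def
    by (subst lborel_integral_real_affine[where c = "-1" and t = t0])
      (auto intro!: Bochner_Integration.integral_cong simp: indicator_def)
  have K_le: "K \<le> m"
    unfolding K_eq m_def set_lebesgue_integral_def
  proof (rule integral_mono')
    show "integrable lborel (\<lambda>u. indicator {0<..<b} u *\<^sub>R (u powr (q - 1) * exp (- l * u)))"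
      using int0 by (simp add: set_integrable_def)
  qed (use t0 in \<open>auto simp: indicator_def\<close>)
  have v_nonneg: "0 \<le> v t0" using nonneg[OF t0] by (simp add: v_def)
  have u_le: "u s \<le> exp (l * s) * v t0" if "s \<in> {0..b}" for s
  proof -
    have "u s = exp (l * s) * v s" by (simp add: v_def exp_minus field_simps)
    then show ?thesis using max[OF that] by simp
  qed
  have cont0: "continuous_on {0..t0} u"
    using continuous_on_subset[OF cont] t0 by auto
  have le: "(LINT s:{0<..<t0}|lborel. (t0 - s) powr (q - 1) * u s)
      \<le> (LINT s:{0<..<t0}|lborel. (t0 - s) powr (q - 1) * (exp (l * s) * v t0))"
  proof (rule set_integral_mono)
    show "set_integrable lborel {0<..<t0} (\<lambda>s. (t0 - s) powr (q - 1) * u s)"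
      using set_integrable_powr_kernel_scaleR[OF q cont0] by simp
    have "continuous_on {0..t0} (\<lambda>s. exp (l * s) * v t0)"
      by (intro continuous_intros)
    from set_integrable_powr_kernel_scaleR[OF q this]
    show "set_integrable lborel {0<..<t0} (\<lambda>s. (t0 - s) powr (q - 1) * (exp (l * s) * v t0))"
      by simp
    show "(t0 - s) powr (q - 1) * u s \<le> (t0 - s) powr (q - 1) * (exp (l * s) * v t0)"
      if "s \<in> {0<..<t0}" for s
      using that t0 u_le[of s] by (intro mult_left_mono) auto
  qed
  have "v t0 \<le> exp (- l * t0) * (L * (LINT s:{0<..<t0}|lborel. (t0 - s) powr (q - 1) * u s))"
    unfolding v_def using ineq[OF t0] by simp
  also have "\<dots> \<le> exp (- l * t0) *
      (L * (LINT s:{0<..<t0}|lborel. (t0 - s) powr (q - 1) * (exp (l * s) * v t0)))"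
    using le L by (intro mult_left_mono) auto
  \<comment> \<open>The outer \<open>exp (- l * t0)\<close> merges with \<open>exp (l * s)\<close>
    into \<open>exp (- l * (t0 - s))\<close>, which leaves the damped kernel of
    \<open>K\<close>.\<close>
  also have "exp (- l * t0) * (L * (LINT s:{0<..<t0}|lborel. (t0 - s) powr (q - 1) * (exp (l * s) * v t0)))
      = L * K * v t0"
  proof -
    have "exp (- l * t0) * (LINT s:{0<..<t0}|lborel. (t0 - s) powr (q - 1) * (exp (l * s) * v t0))
        = (LINT s:{0<..<t0}|lborel. exp (- l * t0) * ((t0 - s) powr (q - 1) * (exp (l * s) * v t0)))"
      by simp
    also have "\<dots> = (LINT s:{0<..<t0}|lborel. (t0 - s) powr (q - 1) * exp (- l * (t0 - s)) * v t0)"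
      by (intro set_lebesgue_integral_cong) (auto simp: algebra_simps exp_diff exp_add exp_minus field_simps)
    also have "\<dots> = K * v t0"
      by (simp add: K_def)
    finally show ?thesis by simp
  qed
  also have "\<dots> \<le> L * m * v t0"
    using K_le L v_nonneg by (intro mult_right_mono mult_left_mono) auto
  also have "\<dots> \<le> 1 / 2 * v t0"
    using Lm v_nonneg by (rule mult_right_mono)
  finally have "v t0 \<le> 0"
    using L by simp
  then have "u t \<le> 0"
    using u_le[OF t] v_nonneg by simp
  then show ?thesis using nonneg[OF t] by simp
qed

text \<open>Both functions solve the same Volterra equation. They are bounded on the compact
  interval, so the quadratic map is Lipschitz along them, and the Gronwall lemma applies to
  \<open>norm (x t - y t)\<close>.\<close>

lemma caputo_bilinear_solution_unique:
  fixes \<beta> :: "'a::euclidean_space \<Rightarrow> 'a \<Rightarrow> 'a"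
  assumes \<beta>: "bounded_bilinear \<beta>" and q: "0 < q" "q < 1"
    and x: "continuous_on {0..b} x" "\<And>t. t \<in> {0<..b} \<Longrightarrow> caputo_differentiable q x t"
      "\<And>t. t \<in> {0<..b} \<Longrightarrow> caputo_deriv q x t = \<beta> (x t) (x t)"
    and y: "continuous_on {0..b} y" "\<And>t. t \<in> {0<..b} \<Longrightarrow> caputo_differentiable q y t"
      "\<And>t. t \<in> {0<..b} \<Longrightarrow> caputo_deriv q y t = \<beta> (y t) (y t)"
    and init: "x 0 = y 0" and t: "t \<in> {0..b}"
  shows "x t = y t"
proof -
  interpret bounded_bilinear \<beta> by (rule \<beta>)
  have volterra: "(LINT s:{0<..<t}|lborel. (t - s) powr (q - 1) *\<^sub>R \<beta> (z s) (z s)) = Gamma q *\<^sub>R (z t - z 0)"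
    if z: "continuous_on {0..b} z" "\<And>t. t \<in> {0<..b} \<Longrightarrow> caputo_differentiable q z t"
      "\<And>t. t \<in> {0<..b} \<Longrightarrow> caputo_deriv q z t = \<beta> (z t) (z t)" and t: "t \<in> {0..b}" for z t
  proof (cases "t = 0")
    case False
    then have t': "t \<in> {0<..b}" using t by simp
    have "continuous_on {0..t} z"
      using continuous_on_subset[OF z(1)] t by auto
    then have "rl_integral q (caputo_deriv q z) t = z t - z 0"
      using q t' z(2) by (intro rl_integral_caputo_deriv) auto
    moreover have "(LINT s:{0<..<t}|lborel. (t - s) powr (q - 1) *\<^sub>R caputo_deriv q z s)
        = (LINT s:{0<..<t}|lborel. (t - s) powr (q - 1) *\<^sub>R \<beta> (z s) (z s))"
      using z(3) t' by (intro set_lebesgue_integral_cong) auto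
    ultimately show ?thesis
      using Gamma_real_pos[OF q(1)] by (auto simp: rl_integral_def vector_fraction_eq_iff)
  qed (simp add: set_lebesgue_integral_def)
  obtain B where B: "0 < B" "\<And>u v. norm (\<beta> u v) \<le> norm u * norm v * B"
    using pos_bounded by blast
  have "compact (x ` {0..b})" "compact (y ` {0..b})"
    using x(1) y(1) compact_continuous_image by blast+
  then obtain M1 M2 where M12: "\<And>s. s \<in> {0..b} \<Longrightarrow> norm (x s) \<le> M1" "\<And>s. s \<in> {0..b} \<Longrightarrow> norm (y s) \<le> M2"
    by (metis bounded_iff compact_imp_bounded imageI)
  define L where "L = (M1 + M2) * B"
  have "0 \<le> M1" "0 \<le> M2"
    using M12[of t] t norm_ge_zero order_trans by blast+
  then have L: "0 \<le> L" using B by (simp add: L_def)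
  have lip: "norm (\<beta> (x s) (x s) - \<beta> (y s) (y s)) \<le> L * norm (x s - y s)" if "s \<in> {0..b}" for s
  proof -
    \<comment> \<open>Inserting the mixed term \<open>\<beta> (y s) (x s)\<close> leaves one factor
      \<open>x s - y s\<close> in each summand.\<close>
    have "\<beta> (x s) (x s) - \<beta> (y s) (y s) = \<beta> (x s - y s) (x s) + \<beta> (y s) (x s - y s)"
      by (simp add: diff_left diff_right)
    also have "norm \<dots> \<le> norm (x s - y s) * norm (x s) * B + norm (y s) * norm (x s - y s) * B"
      using B(2) by (intro norm_triangle_le add_mono) auto
    also have "\<dots> = norm (x s - y s) * B * (norm (x s) + norm (y s))"
      by (simp add: algebra_simps)
    also have "\<dots> \<le> norm (x s - y s) * B * (M1 + M2)"
      using M12[OF that] B(1) by (intro mult_left_mono add_mono) auto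
    finally show ?thesis by (simp add: L_def mult_ac)
  qed
  have "norm (x t - y t) = 0"
  proof (rule fractional_gronwall_zero[where u = "\<lambda>t. norm (x t - y t)", OF q(1) _ _ _ _ t])
    show "0 \<le> L / Gamma q" using L Gamma_real_pos[OF q(1)] by simp
    show cont: "continuous_on {0..b} (\<lambda>t. norm (x t - y t))"
      by (intro continuous_intros x y)
    fix t assume t: "t \<in> {0..b}"
    have sub: "{0..t} \<subseteq> {0..b}" using t by auto
    have c: "continuous_on {0..t} x" "continuous_on {0..t} y"
      using continuous_on_subset[OF _ sub] x(1) y(1) by blast+
    have ix: "set_integrable lborel {0<..<t} (\<lambda>s. (t - s) powr (q - 1) *\<^sub>R \<beta> (x s) (x s))"
      and iy: "set_integrable lborel {0<..<t} (\<lambda>s. (t - s) powr (q - 1) *\<^sub>R \<beta> (y s) (y s))"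
      by (intro set_integrable_powr_kernel_scaleR q continuous_on c)+
    have "Gamma q * norm (x t - y t) = norm (Gamma q *\<^sub>R (x t - x 0) - Gamma q *\<^sub>R (y t - y 0))"
      using Gamma_real_pos[OF q(1)] init by (simp add: scaleR_diff_right[symmetric])
    also have "\<dots> = norm (LINT s:{0<..<t}|lborel.
        (t - s) powr (q - 1) *\<^sub>R \<beta> (x s) (x s) - (t - s) powr (q - 1) *\<^sub>R \<beta> (y s) (y s))"
      using volterra[OF x t] volterra[OF y t] set_integral_diff(2)[OF ix iy] by simp
    also have "\<dots> \<le> (LINT s:{0<..<t}|lborel.
        norm ((t - s) powr (q - 1) *\<^sub>R \<beta> (x s) (x s) - (t - s) powr (q - 1) *\<^sub>R \<beta> (y s) (y s)))"
      using set_integral_norm_bound[OF set_integral_diff(1)[OF ix iy]] by simp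
    also have "\<dots> \<le> (LINT s:{0<..<t}|lborel. L * ((t - s) powr (q - 1) * norm (x s - y s)))"
    proof (rule set_integral_mono)
      show "set_integrable lborel {0<..<t} (\<lambda>s.
          norm ((t - s) powr (q - 1) *\<^sub>R \<beta> (x s) (x s) - (t - s) powr (q - 1) *\<^sub>R \<beta> (y s) (y s)))"
        by (rule set_integrable_norm[OF set_integral_diff(1)[OF ix iy]])
      have "set_integrable lborel {0<..<t} (\<lambda>s. (t - s) powr (q - 1) *\<^sub>R norm (x s - y s))"
        by (intro set_integrable_powr_kernel_scaleR q continuous_intros c)
      then show "set_integrable lborel {0<..<t} (\<lambda>s. L * ((t - s) powr (q - 1) * norm (x s - y s)))"
        by simp
      fix s assume "s \<in> {0<..<t}"
      then have "norm (\<beta> (x s) (x s) - \<beta> (y s) (y s)) \<le> L * norm (x s - y s)"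
        using t by (intro lip) auto
      from mult_left_mono[OF this, of "(t - s) powr (q - 1)"]
      show "norm ((t - s) powr (q - 1) *\<^sub>R \<beta> (x s) (x s) - (t - s) powr (q - 1) *\<^sub>R \<beta> (y s) (y s))
          \<le> L * ((t - s) powr (q - 1) * norm (x s - y s))"
        by (simp add: scaleR_diff_right[symmetric] mult_ac)
    qed
    also have "\<dots> = L * (LINT s:{0<..<t}|lborel. (t - s) powr (q - 1) * norm (x s - y s))"
      by simp
    finally show "norm (x t - y t)
        \<le> L / Gamma q * (LINT s:{0<..<t}|lborel. (t - s) powr (q - 1) * norm (x s - y s))"
      using Gamma_real_pos[OF q(1)] by (simp add: field_simps)
  qed simp
  then show ?thesis by simp
qed

subsection \<open>Existence via fractional power series\<close>

text \<open>Expanding \<open>\<beta>\<close> in the two finite bases reduces the claim to scalar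
  Cauchy products of the coordinate series, which inherit absolute convergence.\<close>

lemma Cauchy_product_sums_bilinear:
  fixes a :: "nat \<Rightarrow> 'a::euclidean_space" and b :: "nat \<Rightarrow> 'b::euclidean_space"
    and \<beta> :: "'a \<Rightarrow> 'b \<Rightarrow> 'c::real_normed_vector"
  assumes \<beta>: "bounded_bilinear \<beta>"
    and a: "summable (\<lambda>n. norm (a n))" and b: "summable (\<lambda>n. norm (b n))"
  shows "(\<lambda>n. \<Sum>k\<le>n. \<beta> (a k) (b (n - k))) sums \<beta> (\<Sum>n. a n) (\<Sum>n. b n)"
proof -
  interpret bounded_bilinear \<beta> by (rule \<beta>)
  have expand: "\<beta> u v = (\<Sum>i\<in>Basis. \<Sum>j\<in>Basis. ((u \<bullet> i) * (v \<bullet> j)) *\<^sub>R \<beta> i j)" for u v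
  proof -
    have "\<beta> u v = \<beta> (\<Sum>i\<in>Basis. (u \<bullet> i) *\<^sub>R i) (\<Sum>j\<in>Basis. (v \<bullet> j) *\<^sub>R j)"
      by (simp only: euclidean_representation)
    also have "\<dots> = (\<Sum>i\<in>Basis. \<Sum>j\<in>Basis. ((u \<bullet> i) * (v \<bullet> j)) *\<^sub>R \<beta> i j)"
      by (subst sum_left, intro sum.cong refl, subst sum_right)
        (simp add: scaleR_left scaleR_right mult.commute)
    finally show ?thesis .
  qed
  have coord: "summable (\<lambda>n. norm (c n \<bullet> i))" "(\<Sum>n. c n) \<bullet> i = (\<Sum>n. c n \<bullet> i)"
    if "summable (\<lambda>n. norm (c n))" "i \<in> Basis" for c :: "nat \<Rightarrow> 'd::euclidean_space" and i
  proof -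
    show "summable (\<lambda>n. norm (c n \<bullet> i))"
      by (rule summable_comparison_test'[OF that(1), of 0]) (use that(2) Basis_le_norm in auto)
    show "(\<Sum>n. c n) \<bullet> i = (\<Sum>n. c n \<bullet> i)"
      using bounded_linear.suminf[OF bounded_linear_inner_left summable_norm_cancel[OF that(1)]] .
  qed
  have "(\<lambda>n. \<Sum>i\<in>Basis. \<Sum>j\<in>Basis. (\<Sum>k\<le>n. (a k \<bullet> i) * (b (n - k) \<bullet> j)) *\<^sub>R \<beta> i j)
      sums (\<Sum>i\<in>Basis. \<Sum>j\<in>Basis. ((\<Sum>n. a n \<bullet> i) * (\<Sum>n. b n \<bullet> j)) *\<^sub>R \<beta> i j)"
    by (intro sums_sum bounded_linear.sums[OF bounded_linear_scaleR_left] Cauchy_product_sums coord a b)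
  also have "(\<lambda>n. \<Sum>i\<in>Basis. \<Sum>j\<in>Basis. (\<Sum>k\<le>n. (a k \<bullet> i) * (b (n - k) \<bullet> j)) *\<^sub>R \<beta> i j)
      = (\<lambda>n. \<Sum>k\<le>n. \<beta> (a k) (b (n - k)))"
  proof
    fix n
    have "(\<Sum>k\<le>n. \<beta> (a k) (b (n - k))) =
        (\<Sum>k\<le>n. \<Sum>i\<in>Basis. \<Sum>j\<in>Basis. ((a k \<bullet> i) * (b (n - k) \<bullet> j)) *\<^sub>R \<beta> i j)"
      by (subst expand) simp
    also have "\<dots> = (\<Sum>i\<in>Basis. \<Sum>k\<le>n. \<Sum>j\<in>Basis. ((a k \<bullet> i) * (b (n - k) \<bullet> j)) *\<^sub>R \<beta> i j)"
      by (rule sum.swap)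
    also have "\<dots> = (\<Sum>i\<in>Basis. \<Sum>j\<in>Basis. \<Sum>k\<le>n. ((a k \<bullet> i) * (b (n - k) \<bullet> j)) *\<^sub>R \<beta> i j)"
      by (intro sum.cong refl) (rule sum.swap)
    finally show "(\<Sum>i\<in>Basis. \<Sum>j\<in>Basis. (\<Sum>k\<le>n. (a k \<bullet> i) * (b (n - k) \<bullet> j)) *\<^sub>R \<beta> i j)
        = (\<Sum>k\<le>n. \<beta> (a k) (b (n - k)))"
      by (simp add: scaleR_sum_left)
  qed
  also have "(\<Sum>i\<in>Basis. \<Sum>j\<in>Basis. ((\<Sum>n. a n \<bullet> i) * (\<Sum>n. b n \<bullet> j)) *\<^sub>R \<beta> i j)
      = \<beta> (\<Sum>n. a n) (\<Sum>n. b n)"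
    by (subst expand, intro sum.cong refl) (simp add: coord a b)
  finally show ?thesis .
qed

text \<open>Each coordinate is a real power series and may be differentiated termwise; the finite
  sum over the basis reassembles the vectors.\<close>

lemma powser_scaleR_has_vector_derivative:
  fixes a :: "nat \<Rightarrow> 'a::euclidean_space"
  assumes sm: "\<And>z. norm z < \<rho> \<Longrightarrow> summable (\<lambda>n. norm (a n) * z ^ n)" and z: "norm z < \<rho>"
  shows "((\<lambda>z::real. \<Sum>n. z ^ n *\<^sub>R a n) has_vector_derivative
    (\<Sum>n. (real (Suc n) * z ^ n) *\<^sub>R a (Suc n))) (at z)"
proof -
  have coeff: "summable (\<lambda>n. (a n \<bullet> i) * y ^ n)" if "norm y < \<rho>" "i \<in> Basis" for i and y :: real
  proof (rule summable_norm_cancel, rule summable_comparison_test'[where N = 0])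
    show "summable (\<lambda>n. norm (a n) * norm y ^ n)"
      using that by (intro sm) simp
    show "norm (norm ((a n \<bullet> i) * y ^ n)) \<le> norm (a n) * norm y ^ n" for n
      using Basis_le_norm[OF that(2), of "a n"] by (simp add: abs_mult power_abs mult_right_mono)
  qed
  have coeff_diffs: "summable (\<lambda>n. diffs (\<lambda>n. a n \<bullet> i) n * z ^ n)" if "i \<in> Basis" for i
    by (rule termdiff_converges[OF z coeff[OF _ that]])
  have "((\<lambda>z. \<Sum>i\<in>Basis. (\<Sum>n. (a n \<bullet> i) * z ^ n) *\<^sub>R i) has_vector_derivative
      (\<Sum>i\<in>Basis. (\<Sum>n. diffs (\<lambda>n. a n \<bullet> i) n * z ^ n) *\<^sub>R i)) (at z)"
  proof (intro has_vector_derivative_sum has_vector_derivative_scaleR[THEN has_vector_derivative_eq_rhs])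
    fix i :: 'a assume i: "i \<in> Basis"
    show "((\<lambda>z. \<Sum>n. (a n \<bullet> i) * z ^ n) has_field_derivative (\<Sum>n. diffs (\<lambda>n. a n \<bullet> i) n * z ^ n)) (at z)"
      using termdiffs_strong'[OF coeff[OF _ i] z] by simp
  qed (auto intro: has_vector_derivative_const)
  also have "(\<Sum>i\<in>Basis. (\<Sum>n. diffs (\<lambda>n. a n \<bullet> i) n * z ^ n) *\<^sub>R i)
      = (\<Sum>n. \<Sum>i\<in>Basis. (diffs (\<lambda>n. a n \<bullet> i) n * z ^ n) *\<^sub>R i)"
    using coeff_diffs
    by (subst suminf_sum) (auto intro!: summable_scaleR_left sum.cong simp: suminf_scaleR_left)
  also have "(\<lambda>n. \<Sum>i\<in>Basis. (diffs (\<lambda>n. a n \<bullet> i) n * z ^ n) *\<^sub>R i)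
      = (\<lambda>n. (real (Suc n) * z ^ n) *\<^sub>R a (Suc n))"
  proof
    fix n
    have "(\<Sum>i\<in>Basis. (diffs (\<lambda>n. a n \<bullet> i) n * z ^ n) *\<^sub>R i)
        = (real (Suc n) * z ^ n) *\<^sub>R (\<Sum>i\<in>Basis. (a (Suc n) \<bullet> i) *\<^sub>R i)"
      by (simp add: diffs_def scaleR_sum_right mult_ac)
    then show "(\<Sum>i\<in>Basis. (diffs (\<lambda>n. a n \<bullet> i) n * z ^ n) *\<^sub>R i)
        = (real (Suc n) * z ^ n) *\<^sub>R a (Suc n)"
      by (simp only: euclidean_representation)
  qed
  finally have deriv: "((\<lambda>z. \<Sum>i\<in>Basis. (\<Sum>n. (a n \<bullet> i) * z ^ n) *\<^sub>R i) has_vector_derivative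
      (\<Sum>n. (real (Suc n) * z ^ n) *\<^sub>R a (Suc n))) (at z)" .
  \<comment> \<open>The coordinate form and the vector series are identified on the open disc of
    convergence, which is enough to transfer the derivative.\<close>
  have eq: "(\<Sum>i\<in>Basis. (\<Sum>n. (a n \<bullet> i) * y ^ n) *\<^sub>R i) = (\<Sum>n. y ^ n *\<^sub>R a n)" if y: "y \<in> ball 0 \<rho>" for y
  proof -
    have "(\<Sum>i\<in>Basis. (\<Sum>n. (a n \<bullet> i) * y ^ n) *\<^sub>R i)
        = (\<Sum>n. \<Sum>i\<in>Basis. ((a n \<bullet> i) * y ^ n) *\<^sub>R i)"
      using coeff y
      by (subst suminf_sum) (auto intro!: summable_scaleR_left sum.cong simp: suminf_scaleR_left)
    also have "(\<lambda>n. \<Sum>i\<in>Basis. ((a n \<bullet> i) * y ^ n) *\<^sub>R i) = (\<lambda>n. y ^ n *\<^sub>R (\<Sum>i\<in>Basis. (a n \<bullet> i) *\<^sub>R i))"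
      by (simp add: scaleR_sum_right mult_ac)
    finally show ?thesis by (simp only: euclidean_representation)
  qed
  show ?thesis
    by (rule has_vector_derivative_transform_within_open[OF deriv open_ball[of 0 \<rho>]])
      (use z eq in auto)
qed

section \<open>Coefficients of the series solution and their growth\<close>

text \<open>The Caputo derivative sends \<open>t powr (q * n + q)\<close> to
  \<open>Gamma (q * n + q + 1) / Gamma (q * n + 1)\<close> times \<open>t powr (q * n)\<close>.
  Comparing coefficients with the Cauchy product for \<open>\<beta> x x\<close> gives this
  recursion.\<close>

fun caputo_coeff :: "real \<Rightarrow> ('a \<Rightarrow> 'a \<Rightarrow> 'a) \<Rightarrow> 'a \<Rightarrow> nat \<Rightarrow> 'a::real_vector" where
  "caputo_coeff q \<beta> x0 0 = x0"
| "caputo_coeff q \<beta> x0 (Suc n) = (Gamma (q * n + 1) / Gamma (q * n + q + 1)) *\<^sub>R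
     (\<Sum>k\<le>n. \<beta> (caputo_coeff q \<beta> x0 k) (caputo_coeff q \<beta> x0 (n - k)))"

text \<open>The subtracted term strengthens the bound 2 so that the induction telescopes.\<close>

lemma sum_inverse_squares_le: "(\<Sum>k\<le>n. 1 / (real k + 1)\<^sup>2) \<le> 2 - 1 / (real n + 1)"
proof (induction n)
  case (Suc n)
  have "1 / (real n + 2)\<^sup>2 \<le> 1 / ((real n + 1) * (real n + 2))"
    by (intro divide_left_mono) (auto simp: power2_eq_square intro!: mult_right_mono)
  also have "\<dots> = 1 / (real n + 1) - 1 / (real n + 2)"
    by (simp add: field_simps)
  finally have "1 / (real n + 2)\<^sup>2 \<le> 1 / (real n + 1) - 1 / (real n + 2)" .
  then show ?case using Suc by (simp add: add.commute)
qed simp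

text \<open>The weight \<open>1 / (n + 1)\<^sup>2\<close> reproduces itself under convolution, which closes the induction
  bounding the coefficients.\<close>

lemma convolution_inverse_squares_le:
  "(\<Sum>k\<le>n. 1 / ((real k + 1)\<^sup>2 * (real (n - k) + 1)\<^sup>2)) \<le> 8 / (real n + 2)\<^sup>2"
proof -
  have pointwise: "1 / ((real k + 1)\<^sup>2 * (real (n - k) + 1)\<^sup>2)
      \<le> 2 / (real n + 2)\<^sup>2 * (1 / (real k + 1)\<^sup>2 + 1 / (real (n - k) + 1)\<^sup>2)" if "k \<le> n" for k
  proof -
    \<comment> \<open>Since \<open>u + v = n + 2\<close>, the claim is
      \<open>(u + v)\<^sup>2 \<le> 2 * (u\<^sup>2 + v\<^sup>2)\<close> after division by
      \<open>(u + v)\<^sup>2 * u\<^sup>2 * v\<^sup>2\<close>.\<close>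
    define u v where "u = real k + 1" and "v = real (n - k) + 1"
    have uv: "0 < u" "0 < v" "real n + 2 = u + v"
      using that by (auto simp: u_def v_def of_nat_diff)
    have "(u + v)\<^sup>2 \<le> 2 * (u\<^sup>2 + v\<^sup>2)"
      using sum_squares_bound[of u v] by (simp add: power2_sum)
    then have "1 / (u\<^sup>2 * v\<^sup>2) \<le> 2 / (u + v)\<^sup>2 * (1 / u\<^sup>2 + 1 / v\<^sup>2)"
      using uv by (simp add: divide_simps)
    then show ?thesis by (simp add: uv u_def v_def)
  qed
  have swap: "(\<Sum>k\<le>n. 1 / (real (n - k) + 1)\<^sup>2) = (\<Sum>k\<le>n. 1 / (real k + 1)\<^sup>2)"
    by (rule sum.reindex_bij_witness[of _ "\<lambda>k. n - k" "\<lambda>k. n - k"]) auto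
  have "(\<Sum>k\<le>n. 1 / ((real k + 1)\<^sup>2 * (real (n - k) + 1)\<^sup>2))
      \<le> (\<Sum>k\<le>n. 2 / (real n + 2)\<^sup>2 * (1 / (real k + 1)\<^sup>2 + 1 / (real (n - k) + 1)\<^sup>2))"
    by (intro sum_mono pointwise) simp
  also have "\<dots> = 2 / (real n + 2)\<^sup>2 * (2 * (\<Sum>k\<le>n. 1 / (real k + 1)\<^sup>2))"
    by (simp only: sum_distrib_left[symmetric] sum.distrib swap mult_2)
  also have "\<dots> \<le> 2 / (real n + 2)\<^sup>2 * (2 * 2)"
    using sum_inverse_squares_le[of n] by (intro mult_left_mono) (auto intro: order_trans)
  finally show ?thesis by simp
qed

text \<open>In this form the monotonicity of \<open>Beta\<close> in its first argument bounds the
  Gamma quotients of the recursion.\<close>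

lemma Gamma_ratio_eq_Beta:
  fixes q x :: real
  assumes "0 < q"
  shows "Gamma x / Gamma (x + q) = Beta x q / Gamma q"
  using assms by (simp add: Beta_def Gamma_real_pos less_imp_neq[symmetric])

text \<open>Strong induction: the convolution of the weights costs 8, the bilinear map costs
  \<open>B\<close>, the Gamma quotient costs \<open>C\<close>, and the second factor
  \<open>K\<close> comes from the product. One extra power of \<open>R = 8 * C * B * K\<close>
  absorbs all of them.\<close>

lemma norm_caputo_coeff_le:
  fixes \<beta> :: "'a::real_normed_vector \<Rightarrow> 'a \<Rightarrow> 'a"
  assumes \<beta>: "bounded_bilinear \<beta>" and q: "0 < q"
  shows "\<exists>K>0. \<exists>R>0. \<forall>n. norm (caputo_coeff q \<beta> x0 n) \<le> K * R ^ n / (real n + 1)\<^sup>2"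
proof -
  interpret bounded_bilinear \<beta> by (rule \<beta>)
  obtain B where B: "0 < B" "\<And>u v. norm (\<beta> u v) \<le> norm u * norm v * B"
    using pos_bounded by blast
  \<comment> \<open>This is the Gamma quotient at \<open>n = 0\<close>, the largest one because
    \<open>Beta\<close> decreases in its first argument.\<close>
  define C where "C = Beta 1 q / Gamma q"
  have C: "0 < C"
    unfolding C_def Beta_def using q
    by (intro divide_pos_pos mult_pos_pos Gamma_real_pos) auto
  \<comment> \<open>The bound must hold at \<open>n = 0\<close>; adding 1 keeps \<open>K\<close>
    positive when \<open>x0 = 0\<close>.\<close>
  define K where "K = norm x0 + 1"
  have K: "0 < K" by (simp add: K_def add_nonneg_pos)
  define R where "R = 8 * C * B * K"
  have R: "0 < R" using B C K by (simp add: R_def)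
  have ratio: "0 \<le> Gamma (q * n + 1) / Gamma (q * n + q + 1)"
    "Gamma (q * n + 1) / Gamma (q * n + q + 1) \<le> C" for n :: nat
  proof -
    have "0 \<le> q * n" using q by simp
    then have "0 < q * n + 1" "0 < q * n + q + 1" using q by linarith+
    then show "0 \<le> Gamma (q * n + 1) / Gamma (q * n + q + 1)"
      by (intro divide_nonneg_nonneg less_imp_le Gamma_real_pos)
    have "Beta (q * n + 1) q \<le> Beta 1 q"
      using q by (intro Beta_real_mono) auto
    then show "Gamma (q * n + 1) / Gamma (q * n + q + 1) \<le> C"
      using Gamma_ratio_eq_Beta[OF q, of "q * n + 1"] Gamma_real_pos[OF q]
      by (simp add: C_def divide_right_mono add_ac)
  qed
  have "norm (caputo_coeff q \<beta> x0 n) \<le> K * R ^ n / (real n + 1)\<^sup>2" for n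
  proof (induction n rule: less_induct)
    case (less n)
    show ?case
    proof (cases n)
      case 0
      then show ?thesis by (simp add: K_def)
    next
      case (Suc m)
      let ?a = "caputo_coeff q \<beta> x0"
      have term_le: "norm (\<beta> (?a k) (?a (m - k)))
          \<le> B * K\<^sup>2 * R ^ m * (1 / ((real k + 1)\<^sup>2 * (real (m - k) + 1)\<^sup>2))" if "k \<le> m" for k
      proof -
        have "norm (\<beta> (?a k) (?a (m - k))) \<le> norm (?a k) * norm (?a (m - k)) * B"
          by (rule B)
        also have "\<dots> \<le> (K * R ^ k / (real k + 1)\<^sup>2) * (K * R ^ (m - k) / (real (m - k) + 1)\<^sup>2) * B"
          using that Suc B K R by (intro mult_right_mono mult_mono less.IH) auto
        also have "\<dots> = B * K\<^sup>2 * (R ^ k * R ^ (m - k)) * (1 / ((real k + 1)\<^sup>2 * (real (m - k) + 1)\<^sup>2))"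
          by (simp add: power2_eq_square)
        also have "R ^ k * R ^ (m - k) = R ^ m"
          using that by (simp add: power_add[symmetric])
        finally show ?thesis .
      qed
      have "norm (\<Sum>k\<le>m. \<beta> (?a k) (?a (m - k)))
          \<le> (\<Sum>k\<le>m. B * K\<^sup>2 * R ^ m * (1 / ((real k + 1)\<^sup>2 * (real (m - k) + 1)\<^sup>2)))"
        by (intro sum_norm_le term_le) simp
      also have "\<dots> = B * K\<^sup>2 * R ^ m * (\<Sum>k\<le>m. 1 / ((real k + 1)\<^sup>2 * (real (m - k) + 1)\<^sup>2))"
        by (simp only: sum_distrib_left)
      also have "\<dots> \<le> B * K\<^sup>2 * R ^ m * (8 / (real m + 2)\<^sup>2)"
        using B K R by (intro mult_left_mono convolution_inverse_squares_le) auto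
      finally have conv: "norm (\<Sum>k\<le>m. \<beta> (?a k) (?a (m - k))) \<le> B * K\<^sup>2 * R ^ m * (8 / (real m + 2)\<^sup>2)" .
      have "norm (?a n) = Gamma (q * m + 1) / Gamma (q * m + q + 1) *
          norm (\<Sum>k\<le>m. \<beta> (?a k) (?a (m - k)))"
        using ratio(1)[of m] by (simp only: Suc caputo_coeff.simps norm_scaleR abs_of_nonneg)
      also have "\<dots> \<le> C * (B * K\<^sup>2 * R ^ m * (8 / (real m + 2)\<^sup>2))"
        using ratio C conv by (intro mult_mono) auto
      also have "\<dots> = K * R ^ n / (real n + 1)\<^sup>2"
        by (simp add: Suc R_def power2_eq_square add_ac)
      finally show ?thesis .
    qed
  qed
  then show ?thesis using K R by blast
qed

section \<open>Termwise Caputo differentiation\<close>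

text \<open>The terms are written \<open>(t powr q) ^ n\<close> rather than \<open>t powr (q * n)\<close> because \<open>0 powr 0 = 0\<close> would
  lose the constant term at \<open>t = 0\<close>.\<close>

lemma caputo_powser:
  fixes a :: "nat \<Rightarrow> 'a::euclidean_space" and q \<rho> t :: real
  assumes q: "0 < q" "q < 1"
    and sm: "\<And>z. norm z < \<rho> \<Longrightarrow> summable (\<lambda>n. norm (a n) * z ^ n)"
    and t: "0 < t" "t powr q < \<rho>"
    and conv: "summable (\<lambda>n. norm ((Gamma (q * n + q + 1) / Gamma (q * n + 1)) *\<^sub>R a (Suc n)) * (t powr q) ^ n)"
  defines "x \<equiv> \<lambda>t. \<Sum>n. (t powr q) ^ n *\<^sub>R a n"
  shows "caputo_differentiable q x t"
    and "caputo_deriv q x t =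
      (\<Sum>n. (t powr q) ^ n *\<^sub>R (Gamma (q * n + q + 1) / Gamma (q * n + 1)) *\<^sub>R a (Suc n))"
proof -
  \<comment> \<open>This is the chain rule for the power series composed with
    \<open>s powr q\<close>.\<close>
  define x' where "x' s = (q * s powr (q - 1)) *\<^sub>R (\<Sum>n. (real (Suc n) * (s powr q) ^ n) *\<^sub>R a (Suc n))" for s
  have less: "s powr q < \<rho>" if "0 < s" "s \<le> t" for s
    using powr_mono2[of q s t] q that t by simp
  have deriv: "(x has_vector_derivative x' s) (at s)" if s: "0 < s" "s \<le> t" for s
  proof -
    have "((\<lambda>s. s powr q) has_vector_derivative q * s powr (q - 1)) (at s)"
      using has_real_derivative_powr[OF s(1)] by (simp add: has_real_derivative_iff_has_vector_derivative)
    moreover have "((\<lambda>z::real. \<Sum>n. z ^ n *\<^sub>R a n) has_vector_derivative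
        (\<Sum>n. (real (Suc n) * (s powr q) ^ n) *\<^sub>R a (Suc n))) (at (s powr q))"
      using less[OF s] by (intro powser_scaleR_has_vector_derivative[OF sm]) auto
    ultimately show ?thesis
      unfolding x'_def x_def by (rule vector_diff_chain_at[unfolded o_def])
  qed
  have vd: "vector_derivative x (at s) = x' s" if "0 < s" "s \<le> t" for s
    using deriv[OF that] by (rule vector_derivative_at)
  \<comment> \<open>The term with index \<open>n + 1\<close> is \<open>s powr (c n)\<close> times
    its coefficient, so \<open>F n\<close> is its derivative multiplied by the Caputo kernel and cut
    off to \<open>(0, t)\<close>.\<close>
  define c where "c n = q * real (Suc n)" for n
  define k where "k n s = indicator {0<..<t} s * ((t - s) powr (- q) * s powr (c n - 1))" for n s
  define F where "F n s = (c n * k n s) *\<^sub>R a (Suc n)" for n s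
  have c: "0 < c n" for n using q by (simp add: c_def)
  have Gq: "0 < Gamma (1 - q)" using q by (intro Gamma_real_pos) simp
  have k_int: "has_bochner_integral lborel (k n) ((t powr q) ^ n * Beta (c n) (1 - q))" for n
  proof -
    have "t powr (c n + (1 - q) - 1) = (t powr q) ^ n"
      using t by (simp add: c_def powr_power algebra_simps)
    then show ?thesis
      using has_bochner_integral_Beta_kernel[OF c[of n] _ t(1), of "1 - q"] q
      by (simp add: k_def[abs_def])
  qed
  have k_nonneg: "0 \<le> k n s" for n s by (simp add: k_def)
  \<comment> \<open>The factor \<open>c n\<close> from differentiation raises
    \<open>Gamma (c n)\<close> to \<open>Gamma (c n + 1)\<close>, which turns the Beta value into
    the Gamma quotient.\<close>
  have c_Beta: "c n * Beta (c n) (1 - q) = Gamma (1 - q) * (Gamma (q * n + q + 1) / Gamma (q * n + 1))" for n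
  proof -
    have "c n \<notin> \<int>\<^sub>\<le>\<^sub>0"
      using c[of n] by (auto elim!: nonpos_Ints_cases)
    then have "c n * Gamma (c n) = Gamma (c n + 1)"
      by (rule Gamma_plus1[symmetric])
    also have "c n + 1 = q * n + q + 1"
      by (simp add: c_def algebra_simps)
    finally have c_Gamma: "c n * Gamma (c n) = Gamma (q * n + q + 1)" .
    have c_plus: "c n + (1 - q) = q * n + 1"
      by (simp add: c_def algebra_simps)
    have "c n * Beta (c n) (1 - q) = Gamma (1 - q) * (c n * Gamma (c n)) / Gamma (c n + (1 - q))"
      by (simp add: Beta_def)
    also have "\<dots> = Gamma (1 - q) * Gamma (q * n + q + 1) / Gamma (q * n + 1)"
      by (simp only: c_Gamma c_plus)
    finally show ?thesis by simp
  qed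
  define G where "G n = (Gamma (q * n + q + 1) / Gamma (q * n + 1)) *\<^sub>R a (Suc n)" for n :: nat
  have F_int: "has_bochner_integral lborel (F n) (Gamma (1 - q) *\<^sub>R (t powr q) ^ n *\<^sub>R G n)" for n
  proof -
    have "has_bochner_integral lborel (\<lambda>s. (c n * k n s) *\<^sub>R a (Suc n))
        ((c n * ((t powr q) ^ n * Beta (c n) (1 - q))) *\<^sub>R a (Suc n))"
      by (intro has_bochner_integral_scaleR_left has_bochner_integral_mult_right k_int)
    moreover have "c n * ((t powr q) ^ n * Beta (c n) (1 - q))
        = Gamma (1 - q) * ((t powr q) ^ n * (Gamma (q * n + q + 1) / Gamma (q * n + 1)))"
      using c_Beta[of n] by (metis mult.left_commute)
    ultimately show ?thesis
      by (simp add: F_def[abs_def] G_def)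
  qed
  have F_norm_int: "(\<integral>s. norm (F n s) \<partial>lborel) = Gamma (1 - q) * (norm (G n) * (t powr q) ^ n)" for n
  proof -
    have "(\<integral>s. norm (F n s) \<partial>lborel) = (\<integral>s. k n s \<partial>lborel) * (c n * norm (a (Suc n)))"
      using c[of n] by (simp add: F_def k_nonneg abs_mult mult_ac)
    also have "\<dots> = (c n * Beta (c n) (1 - q)) * (norm (a (Suc n)) * (t powr q) ^ n)"
      using has_bochner_integral_integral_eq[OF k_int] by simp
    also have "\<dots> = Gamma (1 - q) * (norm (G n) * (t powr q) ^ n)"
      using q by (simp add: c_Beta G_def Gamma_real_pos add_nonneg_pos add_pos_pos less_imp_le abs_of_nonneg)
    finally show ?thesis .
  qed
  have F_eq: "F n s = (indicator {0<..<t} s * (t - s) powr (- q) * q * s powr (q - 1)) *\<^sub>R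
      ((real (Suc n) * (s powr q) ^ n) *\<^sub>R a (Suc n))" for n s
  proof (cases "s \<in> {0<..<t}")
    case True
    then have "s powr (c n - 1) = s powr (q - 1) * (s powr q) ^ n"
      by (simp add: c_def powr_power powr_add[symmetric] algebra_simps)
    then show ?thesis by (simp add: F_def k_def c_def)
  qed (simp add: F_def k_def)
  have deriv_summable: "summable (\<lambda>n. norm ((real (Suc n) * (s powr q) ^ n) *\<^sub>R a (Suc n)))"
    if "0 < s" "s \<le> t" for s
  proof -
    have "summable (\<lambda>n. diffs (\<lambda>n. norm (a n)) n * (s powr q) ^ n)"
      using less[OF that] by (intro termdiff_converges[OF _ sm]) auto
    moreover have "norm ((real (Suc n) * (s powr q) ^ n) *\<^sub>R a (Suc n))
        = diffs (\<lambda>n. norm (a n)) n * (s powr q) ^ n" for n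
      by (simp add: diffs_def)
    ultimately show ?thesis
      by presburger
  qed
  have F_zero: "F n s = 0" if "s \<notin> {0<..<t}" for n s
    unfolding F_def k_def indicator_simps(2)[OF that] by simp
  have F_suminf: "(\<Sum>n. F n s) = indicator {0<..<t} s *\<^sub>R (t - s) powr (- q) *\<^sub>R x' s" for s
  proof (cases "s \<in> {0<..<t}")
    case True
    then have "summable (\<lambda>n. (real (Suc n) * (s powr q) ^ n) *\<^sub>R a (Suc n))"
      by (intro summable_norm_cancel[OF deriv_summable]) auto
    from suminf_scaleR_right[OF this]
    have "(\<Sum>n. F n s) = (indicator {0<..<t} s * (t - s) powr (- q) * q * s powr (q - 1)) *\<^sub>R
        (\<Sum>n. (real (Suc n) * (s powr q) ^ n) *\<^sub>R a (Suc n))"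
      unfolding F_eq by (rule sym)
    then show ?thesis
      by (simp only: x'_def scaleR_scaleR mult.assoc)
  next
    case False
    then show ?thesis
      by (simp add: F_zero)
  qed
  have F_summable: "summable (\<lambda>n. norm (F n s))" for s
  proof (cases "s \<in> {0<..<t}")
    case True
    then show ?thesis
      unfolding F_eq norm_scaleR[of "indicator {0<..<t} s * _ * _ * _"]
      by (intro summable_mult deriv_summable) auto
  next
    case False
    then show ?thesis
      by (simp add: F_zero)
  qed
  \<comment> \<open>Absolute convergence of the image series says that the integrals of
    \<open>norm (F n s)\<close> are summable, which permits the exchange of sum and
    integral.\<close>
  have conv': "summable (\<lambda>n. norm (G n) * (t powr q) ^ n)"
    using conv by (simp only: G_def)
  then have norm_summable: "summable (\<lambda>n. \<integral>s. norm (F n s) \<partial>lborel)"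
    by (simp only: F_norm_int summable_mult)
  note F_sums = integrable_suminf[OF integrable.intros[OF F_int] _ norm_summable]
    sums_integral[OF integrable.intros[OF F_int] _ norm_summable]
  have int: "integrable lborel (\<lambda>s. indicator {0<..<t} s *\<^sub>R (t - s) powr (- q) *\<^sub>R x' s)"
    using F_sums(1) F_summable by (simp add: F_suminf)
  have G_summable: "summable (\<lambda>n. (t powr q) ^ n *\<^sub>R G n)"
    by (rule summable_norm_cancel) (use conv' in \<open>simp add: mult.commute\<close>)
  have "(\<lambda>n. Gamma (1 - q) *\<^sub>R (t powr q) ^ n *\<^sub>R G n)
      sums (\<integral>s. indicator {0<..<t} s *\<^sub>R (t - s) powr (- q) *\<^sub>R x' s \<partial>lborel)"
    using F_sums(2) F_summable by (simp add: F_suminf has_bochner_integral_integral_eq[OF F_int])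
  then have integral: "(\<integral>s. indicator {0<..<t} s *\<^sub>R (t - s) powr (- q) *\<^sub>R x' s \<partial>lborel)
      = Gamma (1 - q) *\<^sub>R (\<Sum>n. (t powr q) ^ n *\<^sub>R G n)"
    using suminf_scaleR_right[OF G_summable] by (simp add: sums_iff)
  have exponent: "1 - q - 1 = - q" by simp
  have integrand: "indicator {0<..<t} s *\<^sub>R (t - s) powr (- q) *\<^sub>R vector_derivative x (at s)
      = indicator {0<..<t} s *\<^sub>R (t - s) powr (- q) *\<^sub>R x' s" for s
    by (cases "s \<in> {0<..<t}") (simp_all add: vd)
  have "x differentiable (at s)" if "s \<in> {0<..<t}" for s
    using deriv[of s] that differentiableI_vector by auto
  then show "caputo_differentiable q x t"
    unfolding caputo_differentiable_def rl_integrable_def set_integrable_def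
    using int by (simp add: integrand del: scaleR_scaleR)
  show "caputo_deriv q x t =
      (\<Sum>n. (t powr q) ^ n *\<^sub>R (Gamma (q * n + q + 1) / Gamma (q * n + 1)) *\<^sub>R a (Suc n))"
    unfolding caputo_deriv_def rl_integral_def set_lebesgue_integral_def exponent integrand integral
      G_def[symmetric]
    using less_imp_neq[OF Gq] by (simp only: scaleR_scaleR) simp
qed

section \<open>Local solution\<close>

text \<open>The coefficient bound gives convergence for \<open>t powr q < 1 / R\<close>, hence for
  \<open>t < T\<close> with \<open>T = (1 / R) powr (1 / q)\<close>. There the termwise Caputo
  derivative is the Cauchy product of the series with itself under \<open>\<beta>\<close>.\<close>

lemma caputo_bilinear_local_solution:
  fixes \<beta> :: "'a::euclidean_space \<Rightarrow> 'a \<Rightarrow> 'a"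
  assumes \<beta>: "bounded_bilinear \<beta>" and q: "0 < q" "q < 1"
  obtains T x where "0 < T" "continuous_on {0..<T} x" "x 0 = x0"
    "\<And>t. t \<in> {0<..<T} \<Longrightarrow> caputo_differentiable q x t"
    "\<And>t. t \<in> {0<..<T} \<Longrightarrow> caputo_deriv q x t = \<beta> (x t) (x t)"
proof -
  interpret bounded_bilinear \<beta> by (rule \<beta>)
  define a where "a = caputo_coeff q \<beta> x0"
  obtain K R where KR: "0 < K" "0 < R" "\<And>n. norm (a n) \<le> K * R ^ n / (real n + 1)\<^sup>2"
    using norm_caputo_coeff_le[OF \<beta> q(1), of x0] unfolding a_def by blast
  define \<rho> where "\<rho> = 1 / R"
  have sm: "summable (\<lambda>n. norm (a n) * z ^ n)" if "norm z < \<rho>" for z :: real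
  proof (rule summable_comparison_test')
    show "summable (\<lambda>n. K * (R * norm z) ^ n)"
      using that KR by (intro summable_mult summable_geometric) (simp add: \<rho>_def field_simps)
    have "norm (a n) \<le> K * R ^ n" for n
    proof -
      have "K * R ^ n / (real n + 1)\<^sup>2 \<le> K * R ^ n / 1"
        using KR by (intro divide_left_mono) auto
      then show ?thesis using KR(3)[of n] by simp
    qed
    then show "norm (norm (a n) * z ^ n) \<le> K * (R * norm z) ^ n" for n
      by (simp add: abs_mult power_abs power_mult_distrib mult.assoc[symmetric] mult_right_mono)
  qed
  define x where "x t = (\<Sum>n. (t powr q) ^ n *\<^sub>R a n)" for t
  define T where "T = \<rho> powr (1 / q)"
  have T: "0 < T" using KR by (simp add: T_def \<rho>_def)
  have less: "t powr q < \<rho>" if "0 \<le> t" "t < T" for t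
  proof -
    have "t powr q < T powr q"
      using that q by (intro powr_less_mono2) auto
    also have "T powr q = \<rho>"
      using q KR by (simp add: T_def \<rho>_def powr_powr)
    finally show ?thesis .
  qed
  have "continuous_on {0..<T} x"
  proof -
    have "isCont (\<lambda>z::real. \<Sum>n. z ^ n *\<^sub>R a n) z" if "z \<in> ball 0 \<rho>" for z
      using that
      by (intro has_vector_derivative_continuous[OF powser_scaleR_has_vector_derivative[OF sm]]) simp_all
    then have "continuous_on (ball 0 \<rho>) (\<lambda>z::real. \<Sum>n. z ^ n *\<^sub>R a n)"
      by (simp add: continuous_at_imp_continuous_on)
    moreover have "continuous_on {0..<T} (\<lambda>t. t powr q)"
      using q by (intro continuous_on_powr' continuous_on_id continuous_on_const) simp
    moreover have "(\<lambda>t. t powr q) ` {0..<T} \<subseteq> ball 0 \<rho>"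
      using less by auto
    ultimately show ?thesis
      unfolding x_def by (rule continuous_on_compose2)
  qed
  moreover have "x 0 = x0"
  proof -
    \<comment> \<open>Here \<open>0 powr q = 0\<close> while \<open>0 ^ 0 = 1\<close>, so exactly
      the constant term survives.\<close>
    have "x 0 = (\<Sum>n. 0 ^ n *\<^sub>R a n)" using q by (simp add: x_def)
    also have "\<dots> = (\<Sum>n\<in>{0}. 0 ^ n *\<^sub>R a n)" by (rule suminf_finite) auto
    finally show ?thesis by (simp add: a_def)
  qed
  moreover have sol: "caputo_differentiable q x t \<and> caputo_deriv q x t = \<beta> (x t) (x t)" if t: "t \<in> {0<..<T}" for t
  proof -
    let ?z = "t powr q"
    have z: "norm ?z < \<rho>" "0 \<le> ?z" using less[of t] t by auto
    define G where "G n = (Gamma (q * n + q + 1) / Gamma (q * n + 1)) *\<^sub>R a (Suc n)" for n :: nat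
    \<comment> \<open>The Gamma quotient produced by differentiation cancels the one in the
      recursion, since neither Gamma value is 0.\<close>
    have G: "G n = (\<Sum>k\<le>n. \<beta> (a k) (a (n - k)))" for n
    proof -
      have "0 \<le> q * n" using q by simp
      then have "0 < q * n + 1" "0 < q * n + q + 1" using q by linarith+
      then have "Gamma (q * n + 1) \<noteq> 0" "Gamma (q * n + q + 1) \<noteq> 0"
        using Gamma_real_pos by (metis less_irrefl)+
      then show ?thesis by (simp add: G_def a_def)
    qed
    have term_eq: "?z ^ n *\<^sub>R G n = (\<Sum>k\<le>n. \<beta> (?z ^ k *\<^sub>R a k) (?z ^ (n - k) *\<^sub>R a (n - k)))" for n
      unfolding G scaleR_sum_right
      by (intro sum.cong refl) (simp add: scaleR_left scaleR_right power_add[symmetric])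
    have az: "summable (\<lambda>n. norm (?z ^ n *\<^sub>R a n))"
      using sm[OF z(1)] z(2) by (simp add: mult.commute)
    obtain B where B: "0 < B" "\<And>u v. norm (\<beta> u v) \<le> norm u * norm v * B"
      using pos_bounded by blast
    \<comment> \<open>The norms are dominated by the Cauchy product of an absolutely convergent
      series with itself; this is the convergence hypothesis of
      \<open>caputo_powser\<close>.\<close>
    have G_summable: "summable (\<lambda>n. norm (G n) * ?z ^ n)"
    proof (rule summable_comparison_test')
      have "summable (\<lambda>n. norm (norm (?z ^ n *\<^sub>R a n)))" using az by simp
      then show "summable (\<lambda>n. (\<Sum>k\<le>n. norm (?z ^ k *\<^sub>R a k) * norm (?z ^ (n - k) *\<^sub>R a (n - k))) * B)"
        by (intro summable_mult2 summable_Cauchy_product)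
      show "norm (norm (G n) * ?z ^ n)
          \<le> (\<Sum>k\<le>n. norm (?z ^ k *\<^sub>R a k) * norm (?z ^ (n - k) *\<^sub>R a (n - k))) * B" for n
      proof -
        have "norm (norm (G n) * ?z ^ n) = norm (?z ^ n *\<^sub>R G n)"
          by simp
        also have "\<dots> \<le> (\<Sum>k\<le>n. norm (?z ^ k *\<^sub>R a k) * norm (?z ^ (n - k) *\<^sub>R a (n - k)) * B)"
          unfolding term_eq by (intro sum_norm_le B(2))
        finally show ?thesis by (simp only: sum_distrib_right)
      qed
    qed
    have "(\<Sum>n. ?z ^ n *\<^sub>R G n) = \<beta> (x t) (x t)"
      using Cauchy_product_sums_bilinear[OF \<beta> az az]
      unfolding term_eq x_def by (rule sums_unique[symmetric])
    moreover have "0 < t" "t powr q < \<rho>"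
      using t less[of t] by simp_all
    note caputo_powser[OF q sm this G_summable[unfolded G_def], folded x_def[abs_def] G_def]
    ultimately show ?thesis by simp
  qed
  ultimately show thesis using that[OF T] by blast
qed

section \<open>Application to the Lagrange system\<close>

text \<open>The right-hand side is the diagonal of this map: \<open>u\<close> supplies the scalar
  components and \<open>v\<close> the vector. Boundedness is automatic in finite dimension.\<close>

lemma lagrange_bounded_bilinear:
  "bounded_bilinear (\<lambda>u v. (u $ 1) *\<^sub>R (lagrange_A *v v) + (u $ 3) *\<^sub>R (lagrange_B *v v))"
proof -
  have "bilinear (\<lambda>u v. (u $ 1) *\<^sub>R (lagrange_A *v v) + (u $ 3) *\<^sub>R (lagrange_B *v v))"
    unfolding bilinear_def
    by (auto intro!: linearI simp: algebra_simps matrix_vector_right_distrib matrix_vector_mult_scaleR)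
  then show ?thesis by (simp add: bilinear_conv_bounded_bilinear)
qed

text \<open>Existence is local, with \<open>T\<close> allowed to depend on \<open>x0\<close>: for
  equal positive components the system reduces to the scalar equation with right-hand side
  \<open>y\<^sup>2\<close>, which blows up in finite time. Uniqueness is claimed for every
  \<open>\<tau>\<close>, on the interval where the values matter.\<close>

theorem proposition2p1:
  fixes q :: real and x0 :: "real^3"
  assumes "0 < q" and "q < 1"
  shows "(\<exists>T>0. \<forall>\<tau>. 0 < \<tau> \<and> \<tau> \<le> T \<longrightarrow> (\<exists>x. lagrange_solution q \<tau> x0 x)) \<and>
         (\<forall>\<tau> x y. 0 < \<tau> \<and> lagrange_solution q \<tau> x0 x \<and> lagrange_solution q \<tau> x0 y \<longrightarrow>
            (\<forall>t\<in>{0..<\<tau>}. x t = y t))"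
proof (intro conjI allI impI ballI)
  obtain T x where T: "0 < T" and x: "continuous_on {0..<T} x" "x 0 = x0"
    "\<And>t. t \<in> {0<..<T} \<Longrightarrow> caputo_differentiable q x t"
    "\<And>t. t \<in> {0<..<T} \<Longrightarrow> caputo_deriv q x t =
       (x t $ 1) *\<^sub>R (lagrange_A *v x t) + (x t $ 3) *\<^sub>R (lagrange_B *v x t)"
    using caputo_bilinear_local_solution[OF lagrange_bounded_bilinear assms, of x0] by metis
  \<comment> \<open>One function serves all \<open>\<tau> \<le> T\<close>, because the conditions
    pass to shorter intervals.\<close>
  have "lagrange_solution q \<tau> x0 x" if "\<tau> \<le> T" for \<tau>
    unfolding lagrange_solution_def
    using that x by (auto intro: continuous_on_subset)
  then show "\<exists>T>0. \<forall>\<tau>. 0 < \<tau> \<and> \<tau> \<le> T \<longrightarrow> (\<exists>x. lagrange_solution q \<tau> x0 x)"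
    using T by blast
next
  fix \<tau> x y t
  assume "0 < \<tau> \<and> lagrange_solution q \<tau> x0 x \<and> lagrange_solution q \<tau> x0 y" and t: "t \<in> {0..<\<tau>}"
  then have sol: "lagrange_solution q \<tau> x0 x" "lagrange_solution q \<tau> x0 y" by auto
  have sub: "{0..t} \<subseteq> {0..<\<tau>}" using t by auto
  show "x t = y t"
  \<comment> \<open>Solutions are continuous on a half-open interval only, so the comparison runs on
    the compact interval \<open>{0..t}\<close> for each \<open>t < \<tau>\<close>.\<close>
  proof (rule caputo_bilinear_solution_unique[OF lagrange_bounded_bilinear assms, where b = t])
    show "continuous_on {0..t} x" "continuous_on {0..t} y" "x 0 = y 0"
      using sol continuous_on_subset[OF _ sub] by (auto simp: lagrange_solution_def)
  qed (use sol t in \<open>auto simp: lagrange_solution_def\<close>)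
qed

end
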